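(* Let $Q\in\mathbb{R}^{n\times n}$ be a symmetric matrix, $q\in\mathbb{R}^n$, and $C\subset\mathbb{R}^n$ a nonempty closed convex set. For any $x^0\in\mathbb{R}^n$, $\rho>0$, and $\eta>0$, there exists a unique $C^1$ function $x:\mathbb{R}\to\mathbb{R}^n$ such that $x(0)=x^0$ and $$\dot{x}(t)=\frac{1}{\eta}\left[P_C\left(x(t)-\frac{1}{\rho}\big(Qx(t)+q\big)\right)-x(t)\right]\quad\text{for all } t\in\mathbb{R}.$$
   Context: $P_C(u)$ denotes the metric (Euclidean nearest-point) projection of $u\in\mathbb{R}^n$ onto the closed convex set $C$. *)

theory Defs
  imports "HOL-Analysis.Analysis"
begin

end

theory Submission
  imports Defs
begin

text \<open>The right-hand side is globally Lipschitz because the projection is nonexpansive. For an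
  L-Lipschitz field F with L > 0, substitute x(t) = a + exp(2L|t|) u(t) with u bounded and continuous: in this
  weighted (Bielecki) sup norm the Picard operator is a contraction with constant 1/2 on the whole
  line, so no local solutions have to be glued. Uniqueness follows since |x - y|^2, weighted by
  exp(-2Lt) or exp(2Lt), is monotone for two solutions x, y.\<close>

section \<open>Antiderivatives on the whole line and their exponential growth\<close>

lemma continuous_imp_antiderivative:
  fixes h :: "real \<Rightarrow> 'a::banach"
  assumes h: "continuous_on UNIV h"
  obtains H where "H 0 = 0" "\<And>t. (H has_vector_derivative h t) (at t)"
proof -
  \<comment> \<open>Oriented integral from 0 to \<open>t\<close>: an integral over
    \<open>{0..t}\<close> with \<open>t < 0\<close> is over an empty interval, so negative times
    need the sign flip.\<close>
  define H where "H t = (if 0 \<le> t then integral {0..t} h else - integral {t..0} h)" for t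
  have int: "h integrable_on {a..b}" for a b
    by (rule integrable_continuous_real) (use h continuous_on_subset in blast)
  have "(H has_vector_derivative h t) (at t)" for t
  proof -
    \<comment> \<open>The interval from \<open>-N\<close> to \<open>N\<close> contains both 0 and
      \<open>t\<close> in its interior. On it \<open>H\<close> differs by a constant from the
      integral with fixed left end \<open>-N\<close>, to which the fundamental theorem of calculus
      applies, also across 0.\<close>
    define N where "N = \<bar>t\<bar> + 1"
    have eq: "H s = integral {-N..s} h - integral {-N..0} h" if "s \<in> {-N<..<N}" for s
    proof (cases "0 \<le> s")
      case True
      then have "integral {-N..0} h + integral {0..s} h = integral {-N..s} h"
        using that by (intro Henstock_Kurzweil_Integration.integral_combine int) auto
      then show ?thesis using True by (simp add: H_def algebra_simps)
    next
      case False
      then have "integral {-N..s} h + integral {s..0} h = integral {-N..0} h"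
        using that by (intro Henstock_Kurzweil_Integration.integral_combine int) auto
      then show ?thesis using False by (simp add: H_def algebra_simps)
    qed
    have t: "t \<in> {-N<..<N}" by (auto simp: N_def)
    have "((\<lambda>s. integral {-N..s} h) has_vector_derivative h t) (at t within {-N..N})"
      by (rule integral_has_vector_derivative) (use h continuous_on_subset t in auto)
    then have "((\<lambda>s. integral {-N..s} h) has_vector_derivative h t) (at t within {-N<..<N})"
      by (rule has_vector_derivative_within_subset) auto
    then have "((\<lambda>s. integral {-N..s} h) has_vector_derivative h t) (at t)"
      by (simp only: at_within_open[OF t open_greaterThanLessThan])
    then have "((\<lambda>s. integral {-N..s} h - integral {-N..0} h) has_vector_derivative h t) (at t)"
      by (simp add: has_vector_derivative_diff_const)
    then show ?thesis
      by (rule has_vector_derivative_transform_within_open[OF _ _ t]) (auto simp: eq)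
  qed
  then show ?thesis
    by (rule that[rotated]) (simp add: H_def)
qed

text \<open>Mean value inequality against \<open>c / K * exp (K * s)\<close>, whose derivative is
  the given bound. The factor \<open>1 / K\<close> gained by integrating an exponential is what
  later makes the Picard operator a contraction.\<close>

lemma norm_le_exp_if_vector_derivative_le_exp_nonneg:
  fixes H :: "real \<Rightarrow> 'a::real_normed_vector"
  assumes "H 0 = 0" "K > 0" "c \<ge> 0" "t \<ge> 0"
    and der: "\<And>s. (H has_vector_derivative h s) (at s)"
    and le: "\<And>s. s \<ge> 0 \<Longrightarrow> norm (h s) \<le> c * exp (K * s)"
  shows "norm (H t) \<le> c / K * exp (K * t)"
proof (cases "t = 0")
  case True
  then show ?thesis using assms by simp
next
  case False
  have "norm (H t - H 0) \<le> c / K * exp (K * t) - c / K * exp (K * 0)"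
  proof (rule differentiable_bound_general[where f' = h and \<phi>' = "\<lambda>s. c * exp (K * s)"])
    show "0 < t" using False \<open>t \<ge> 0\<close> by simp
    show "continuous_on {0..t} H"
      by (rule continuous_on_vector_derivative) (rule has_vector_derivative_at_within[OF der])
    show "continuous_on {0..t} (\<lambda>s. c / K * exp (K * s))"
      by (intro continuous_intros)
    show "((\<lambda>s. c / K * exp (K * s)) has_vector_derivative c * exp (K * s)) (at s)" for s
      using \<open>K > 0\<close> unfolding has_real_derivative_iff_has_vector_derivative[symmetric]
      by (auto intro!: derivative_eq_intros)
  qed (use der le in auto)
  moreover have "0 \<le> c / K" using assms by simp
  ultimately show ?thesis using \<open>H 0 = 0\<close> by simp
qed

lemma norm_le_exp_abs_if_vector_derivative_le_exp_abs:
  fixes H :: "real \<Rightarrow> 'a::real_normed_vector"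
  assumes "H 0 = 0" "K > 0" "c \<ge> 0"
    and der: "\<And>s. (H has_vector_derivative h s) (at s)"
    and le: "\<And>s. norm (h s) \<le> c * exp (K * \<bar>s\<bar>)"
  shows "norm (H t) \<le> c / K * exp (K * \<bar>t\<bar>)"
proof (cases "t \<ge> 0")
  case True
  show ?thesis
    using norm_le_exp_if_vector_derivative_le_exp_nonneg[OF assms(1-3) True der] le True
    by (metis abs_of_nonneg)
next
  \<comment> \<open>Negative times reduce to positive ones by the reflection of \<open>s\<close> to
    \<open>- s\<close>.\<close>
  case False
  have "((\<lambda>s. H (- s)) has_vector_derivative - h (- s)) (at s)" for s
  proof -
    have "(uminus has_vector_derivative - 1) (at s)"
      by (auto intro!: derivative_eq_intros)
    from vector_diff_chain_at[OF this der] show ?thesis by (simp add: o_def)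
  qed
  moreover have "norm (- h (- s)) \<le> c * exp (K * s)" if "s \<ge> 0" for s
    using le[of "- s"] that by simp
  ultimately have "norm (H (- (- t))) \<le> c / K * exp (K * (- t))"
    using False assms(1-3)
    by (intro norm_le_exp_if_vector_derivative_le_exp_nonneg[where H = "\<lambda>s. H (- s)"]) auto
  then show ?thesis using False by simp
qed

section \<open>Global existence by a weighted Picard operator\<close>

lemma lipschitz_ode_exists:
  fixes F :: "'a::banach \<Rightarrow> 'a"
  assumes F: "L-lipschitz_on UNIV F"
  obtains x where "x 0 = a" "\<And>t. (x has_vector_derivative F (x t)) (at t)"
proof -
  \<comment> \<open>\<open>L\<close> may be 0; enlarging it keeps the growth rate \<open>K\<close>
    positive, so that division by \<open>K\<close> makes sense.\<close>
  define M where "M = max L 1"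
  have M: "M > 0" by (simp add: M_def)
  have "M-lipschitz_on UNIV F"
    using F by (rule lipschitz_on_le) (simp add: M_def)
  then have lip: "norm (F x - F y) \<le> M * norm (x - y)" for x y
    by (rule lipschitz_on_normD) auto
  have contF: "continuous_on UNIV F"
    using F by (rule lipschitz_on_continuous_on)
  \<comment> \<open>Integration contributes \<open>1 / K\<close> and the Lipschitz bound contributes
    \<open>M\<close>, so this choice gives the contraction constant
    \<open>M / K = 1 / 2\<close>.\<close>
  define K where "K = 2 * M"
  have K: "K > 0" using M by (simp add: K_def)
  define e where "e t = exp (K * \<bar>t\<bar>)" for t :: real
  have e1: "e t \<ge> 1" and e0: "e t > 0" for t using K by (auto simp: e_def)
  have conte: "continuous_on UNIV e" unfolding e_def by (intro continuous_intros)
  \<comment> \<open>The Picard integrand: the field along the candidate curve encoded by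
    \<open>u\<close>.\<close>
  define h where "h u t = F (a + e t *\<^sub>R apply_bcontfun u t)" for u :: "real \<Rightarrow>\<^sub>C 'a" and t
  have "continuous_on UNIV (h u)" for u
    unfolding h_def
    by (rule continuous_on_compose2[OF contF]) (intro continuous_intros conte continuous_on_apply_bcontfun subset_UNIV)+
  then have "\<exists>H. H 0 = 0 \<and> (\<forall>t. (H has_vector_derivative h u t) (at t))" for u
    by (metis continuous_imp_antiderivative)
  then obtain H where H0: "H u 0 = 0" and H: "(H u has_vector_derivative h u t) (at t)" for u t
    by metis
  have bcont: "(\<lambda>t. (1 / e t) *\<^sub>R H u t) \<in> bcontfun" for u
  proof (rule bcontfun_normI)
    have "continuous_on UNIV (H u)"
      by (rule continuous_on_vector_derivative) (rule has_vector_derivative_at_within[OF H])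
    then show "continuous_on UNIV (\<lambda>t. (1 / e t) *\<^sub>R H u t)"
      using e0 by (intro continuous_intros conte) (auto simp: less_le)
    \<comment> \<open>Linear growth of \<open>F\<close> around \<open>a\<close> bounds
      \<open>h u\<close> by a multiple of \<open>e\<close>; the constant term
      \<open>norm (F a)\<close> is absorbed because \<open>e\<close> is at least 1. Hence dividing
      the antiderivative by \<open>e\<close> gives a bounded function again.\<close>
    define c where "c = norm (F a) + M * norm u"
    have c: "c \<ge> 0" using M by (simp add: c_def)
    have "norm (h u s) \<le> c * exp (K * \<bar>s\<bar>)" for s
    proof -
      have "norm (h u s) \<le> norm (F a) + norm (h u s - F a)"
        by (rule norm_triangle_sub)
      also have "norm (h u s - F a) \<le> M * norm (e s *\<^sub>R apply_bcontfun u s)"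
        using lip[of "a + e s *\<^sub>R apply_bcontfun u s" a] by (simp add: h_def)
      also have "\<dots> \<le> M * (e s * norm u)"
        using M e0[of s] norm_bounded[of u s] by (simp add: mult_left_mono)
      also have "norm (F a) \<le> norm (F a) * e s"
        using e1[of s] by (simp add: mult_le_cancel_left1)
      finally show ?thesis by (simp add: c_def e_def algebra_simps)
    qed
    then have "norm (H u t) \<le> c / K * e t" for t
      unfolding e_def by (rule norm_le_exp_abs_if_vector_derivative_le_exp_abs[OF H0 K c H])
    then show "norm ((1 / e t) *\<^sub>R H u t) \<le> c / K" for t
      using e0[of t] by (simp add: pos_divide_le_eq)
  qed
  define T where "T u = Bcontfun (\<lambda>t. (1 / e t) *\<^sub>R H u t)" for u
  have T: "apply_bcontfun (T u) t = (1 / e t) *\<^sub>R H u t" for u t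
    by (simp only: T_def Bcontfun_inverse[OF bcont])
  have "dist (T u) (T v) \<le> 1 / 2 * dist u v" for u v
  proof (rule dist_bound)
    \<comment> \<open>In the difference of two integrands \<open>a\<close> cancels, and the
      pointwise distance of \<open>u\<close> and \<open>v\<close> is amplified by at most
      \<open>M * e s\<close>.\<close>
    define c where "c = M * dist u v"
    have c: "c \<ge> 0" using M by (simp add: c_def)
    have der: "((\<lambda>t. H u t - H v t) has_vector_derivative h u t - h v t) (at t)" for t
      by (intro has_vector_derivative_diff H)
    have "norm (h u s - h v s) \<le> c * exp (K * \<bar>s\<bar>)" for s
    proof -
      have "norm (h u s - h v s)
          \<le> M * norm (e s *\<^sub>R (apply_bcontfun u s - apply_bcontfun v s))"
        using lip[of "a + e s *\<^sub>R apply_bcontfun u s" "a + e s *\<^sub>R apply_bcontfun v s"]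
        by (simp add: h_def algebra_simps)
      also have "\<dots> \<le> M * (e s * dist u v)"
        using M e0[of s] dist_bounded[of u s v]
        by (simp add: mult_left_mono dist_norm)
      finally show ?thesis by (simp add: c_def e_def algebra_simps)
    qed
    then have "norm (H u t - H v t) \<le> c / K * e t" for t
      unfolding e_def
      by (intro norm_le_exp_abs_if_vector_derivative_le_exp_abs[OF _ K c der]) (auto simp: H0)
    moreover have "c / K = 1 / 2 * dist u v" using M by (simp add: c_def K_def)
    ultimately show "dist (apply_bcontfun (T u) t) (apply_bcontfun (T v) t) \<le> 1 / 2 * dist u v"
      for t
      using e0[of t] unfolding T dist_norm scaleR_diff_right[symmetric]
      by (simp add: pos_divide_le_eq)
  qed
  then have "\<exists>!u. T u = u"
    by (intro banach_fix_type[of "1 / 2"]) simp_all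
  then obtain u where u: "T u = u"
    by blast
  \<comment> \<open>The fixed point equation without the weight: \<open>a + H u t\<close> is the
    very curve at which \<open>h u t\<close> evaluates \<open>F\<close>, hence a solution.\<close>
  have Hu: "H u t = e t *\<^sub>R apply_bcontfun u t" for t
    using T[of u t] e0[of t] u by simp
  show ?thesis
  proof
    show "a + H u 0 = a" by (simp add: H0)
    have "((\<lambda>t. a + H u t) has_vector_derivative 0 + h u t) (at t)" for t
      by (intro has_vector_derivative_add has_vector_derivative_const H)
    then show "((\<lambda>t. a + H u t) has_vector_derivative F (a + H u t)) (at t)" for t
      by (simp add: h_def Hu)
  qed
qed

section \<open>Uniqueness by a weighted squared distance\<close>

lemma lipschitz_ode_unique:
  fixes F :: "'a::real_inner \<Rightarrow> 'a"
  assumes F: "L-lipschitz_on UNIV F"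
    and x: "\<And>t. (x has_vector_derivative F (x t)) (at t)"
    and y: "\<And>t. (y has_vector_derivative F (y t)) (at t)"
    and init: "x 0 = y 0"
  shows "x = y"
proof
  fix t :: real
  define d where "d s = x s - y s" for s
  \<comment> \<open>The squared distance, unlike the distance itself, is differentiable also where
    the two solutions meet.\<close>
  define g where "g s = d s \<bullet> d s" for s
  define g' where "g' s = 2 * (d s \<bullet> (F (x s) - F (y s)))" for s
  have g0: "g 0 = 0" by (simp add: g_def d_def init)
  have "(d has_vector_derivative F (x s) - F (y s)) (at s)" for s
    unfolding d_def by (intro has_vector_derivative_diff x y)
  then have d: "(d has_derivative (\<lambda>r. r *\<^sub>R (F (x s) - F (y s)))) (at s)" for s
    by (simp add: has_vector_derivative_def)
  have der: "(g has_real_derivative g' s) (at s)" for s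
    unfolding has_field_derivative_def g_def
    by (rule has_derivative_eq_rhs[OF has_derivative_inner[OF d d]])
      (simp add: fun_eq_iff g'_def inner_commute)
  have bound: "\<bar>g' s\<bar> \<le> 2 * L * g s" for s
  proof -
    have "\<bar>g' s\<bar> \<le> 2 * (norm (d s) * norm (F (x s) - F (y s)))"
      using Cauchy_Schwarz_ineq2[of "d s" "F (x s) - F (y s)"] by (simp add: g'_def abs_mult)
    also have "\<dots> \<le> 2 * (norm (d s) * (L * norm (d s)))"
      using lipschitz_on_normD[OF F, of "x s" "y s"] by (simp add: d_def mult_left_mono)
    finally show ?thesis by (simp add: g_def dot_square_norm power2_eq_square mult_ac)
  qed
  \<comment> \<open>The two-sided bound on \<open>g'\<close> fixes the sign of
    \<open>k * g s + g' s\<close> for \<open>k = - (2 * L)\<close> (forward in time) and for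
    \<open>k = 2 * L\<close> (backward).\<close>
  have weighted: "((\<lambda>s. exp (k * s) * g s) has_real_derivative exp (k * s) * (k * g s + g' s)) (at s)"
    for k s
    by (auto intro!: derivative_eq_intros der simp: algebra_simps)
  \<comment> \<open>Either way the weighted value at \<open>t\<close> is at most that at 0, which
    vanishes; being a squared norm, \<open>g t\<close> is then 0.\<close>
  have "g t \<le> 0"
  proof (cases "t \<ge> 0")
    case True
    have "exp (- (2 * L) * t) * g t \<le> exp (- (2 * L) * 0) * g 0"
    proof (rule DERIV_nonpos_imp_nonincreasing[OF True, where f = "\<lambda>s. exp (- (2 * L) * s) * g s"])
      fix s
      have "- (2 * L) * g s + g' s \<le> 0" using bound[of s] by simp
      then have "exp (- (2 * L) * s) * (- (2 * L) * g s + g' s) \<le> 0"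
        by (simp add: mult_le_0_iff)
      with weighted show "\<exists>z. ((\<lambda>s. exp (- (2 * L) * s) * g s) has_real_derivative z) (at s) \<and> z \<le> 0"
        by blast
    qed
    then show ?thesis by (simp add: g0 mult_le_0_iff)
  next
    case False
    have "exp (2 * L * t) * g t \<le> exp (2 * L * 0) * g 0"
    proof (rule DERIV_nonneg_imp_nondecreasing[where f = "\<lambda>s. exp (2 * L * s) * g s"])
      show "t \<le> 0" using False by simp
      fix s
      have "0 \<le> 2 * L * g s + g' s" using bound[of s] by simp
      then have "0 \<le> exp (2 * L * s) * (2 * L * g s + g' s)" by simp
      with weighted show "\<exists>z. ((\<lambda>s. exp (2 * L * s) * g s) has_real_derivative z) (at s) \<and> 0 \<le> z"
        by blast
    qed
    then show ?thesis by (simp add: g0 mult_le_0_iff)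
  qed
  then have "d t = 0" by (simp add: g_def dot_square_norm)
  then show "x t = y t" by (simp add: d_def)
qed

section \<open>Regularity and the projected gradient field\<close>

lemma autonomous_ode_C1:
  fixes F :: "'a::real_normed_vector \<Rightarrow> 'a"
  assumes F: "continuous_on UNIV F"
    and x: "\<And>t. (x has_vector_derivative F (x t)) (at t)"
  shows "x C1_differentiable_on UNIV"
proof -
  have "continuous_on UNIV x"
    by (rule continuous_on_vector_derivative) (rule has_vector_derivative_at_within[OF x])
  then have "continuous_on UNIV (\<lambda>t. F (x t))"
    by (rule continuous_on_compose2[OF F]) auto
  then show ?thesis
    unfolding C1_differentiable_on_def using x by (intro exI[of _ "\<lambda>t. F (x t)"]) simp
qed

lemma projected_gradient_field_lipschitz:
  fixes A :: "'a::euclidean_space \<Rightarrow> 'a"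
  assumes C: "C \<noteq> {}" "closed C" "convex C" and A: "bounded_linear A"
  obtains L where
    "L-lipschitz_on UNIV (\<lambda>z. a *\<^sub>R (closest_point C (z - b *\<^sub>R (A z + q)) - z))"
proof -
  obtain B where B: "B-lipschitz_on UNIV A"
    using bounded_linear.lipschitz_boundE[OF A] .
  \<comment> \<open>\<open>S\<close> is arbitrary because the composition below needs this on the
    range of the inner map.\<close>
  have P: "1-lipschitz_on S (closest_point C)" for S
    using closest_point_lipschitz[OF C(3,2,1)] by (auto intro: lipschitz_onI)
  \<comment> \<open>The summands are the constants of the identity, of \<open>A\<close> and of the
    constant map \<open>q\<close>.\<close>
  have "(1 + \<bar>b\<bar> * (B + 0))-lipschitz_on UNIV (\<lambda>z. z - b *\<^sub>R (A z + q))"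
    by (intro lipschitz_on_diff lipschitz_on_id lipschitz_on_cmult lipschitz_on_add
        lipschitz_on_constant B)
  from lipschitz_on_compose2[OF this P] show ?thesis
    by (rule that[OF lipschitz_on_cmult[OF lipschitz_on_diff[OF _ lipschitz_on_id]]])
qed

theorem theorem2p1:
  fixes Q :: "real ^ 'n ^ 'n" and q x0 :: "real ^ 'n" and C :: "(real ^ 'n) set"
    and \<rho> \<eta> :: real
  assumes "transpose Q = Q"
    and "C \<noteq> {}" and "closed C" and "convex C"
    and "\<rho> > 0" and "\<eta> > 0"
  shows "\<exists>!x :: real \<Rightarrow> real ^ 'n.
           x C1_differentiable_on UNIV \<and> x 0 = x0 \<and>
           (\<forall>t. (x has_vector_derivative
              (1 / \<eta>) *\<^sub>R (closest_point C (x t - (1 / \<rho>) *\<^sub>R (Q *v x t + q)) - x t)) (at t))"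
proof -
  \<comment> \<open>By symmetry of \<open>Q\<close>, \<open>Q *v z + q\<close> is the gradient of
    half of \<open>z \<bullet> (Q *v z)\<close> plus \<open>q \<bullet> z\<close>; the field points
    from \<open>z\<close> to its projected gradient step of size \<open>1 / \<rho>\<close>.\<close>
  define F where "F z = (1 / \<eta>) *\<^sub>R (closest_point C (z - (1 / \<rho>) *\<^sub>R (Q *v z + q)) - z)" for z
  obtain L where L: "L-lipschitz_on UNIV F"
    unfolding F_def
    by (rule projected_gradient_field_lipschitz[OF assms(2-4) matrix_vector_mul_bounded_linear])
  obtain x where x: "x 0 = x0" "\<And>t. (x has_vector_derivative F (x t)) (at t)"
    using lipschitz_ode_exists[OF L] by metis
  have "x C1_differentiable_on UNIV"
    using lipschitz_on_continuous_on[OF L] x(2) by (rule autonomous_ode_C1)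
  \<comment> \<open>Uniqueness holds among all differentiable solutions, in particular among the C1
    ones.\<close>
  with x lipschitz_ode_unique[OF L]
  have "\<exists>!x. x C1_differentiable_on UNIV \<and> x 0 = x0 \<and>
      (\<forall>t. (x has_vector_derivative F (x t)) (at t))"
    by (intro ex1I[of _ x]) auto
  then show ?thesis by (simp only: F_def)
qed

end
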